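(* Every $n$-node directed graph $G$ admits an exact distance-preserving DAG cover (i.e., a $1$-distance-preserving DAG cover) with $O\!\left(\frac{n^2(\log\log n)^4}{\log^2 n}\right)$ additional edges and $n^{o(1)}$ DAGs.
   Context: Let $G$ be a weighted directed graph with $n$ vertices. A DAG cover of $G$ with $f$ additional edges and $g$ DAGs is a collection $D_1,\dots,D_g$ of weighted directed acyclic graphs, each with vertex set $V(G)$, such that $\left|\left(\bigcup_i E(D_i)\right)\setminus E(G)\right|\le f$. It is $\alpha$-distance-preserving if for all $s,t\in V(G)$, $\mathrm{dist}_G(s,t)\le \min_{i\in[g]}\mathrm{dist}_{D_i}(s,t)\le \alpha\cdot \mathrm{dist}_G(s,t)$ (with $\mathrm{dist}=\infty$ when there is no path). Exact distance-preserving means $\alpha=1$. *)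

theory Defs
  imports "Graph_Theory.Graph_Theory" "HOL-Library.Landau_Symbols"
begin

definition weighted_digraph :: "'a pair_pre_digraph \<Rightarrow> ('a \<times> 'a) weight_fun \<Rightarrow> bool" where
  "weighted_digraph G w \<longleftrightarrow> pair_fin_digraph G \<and> (\<forall>e\<in>parcs G. 0 \<le> w e)"

definition dist_in :: "'a pair_pre_digraph \<Rightarrow> ('a \<times> 'a) weight_fun \<Rightarrow> 'a \<Rightarrow> 'a \<Rightarrow> ereal" where
  "dist_in G w s t = wf_digraph.\<mu> (with_proj G) w s t"

(* Edges are compared together with their weights: an arc of G that a DAG uses with a different
   weight is an additional edge. With unweighted arcs, reweighting arcs of G would be free, and
   for complete G no additional edge would ever be needed. *)
definition weighted_arcs ::
  "'a pair_pre_digraph \<Rightarrow> ('a \<times> 'a) weight_fun \<Rightarrow> (('a \<times> 'a) \<times> real) set" where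
  "weighted_arcs G w = (\<lambda>e. (e, w e)) ` parcs G"

definition dag_cover ::
  "'a pair_pre_digraph \<Rightarrow> ('a \<times> 'a) weight_fun \<Rightarrow> nat \<Rightarrow> nat \<Rightarrow>
   (nat \<Rightarrow> 'a pair_pre_digraph) \<Rightarrow> (nat \<Rightarrow> ('a \<times> 'a) weight_fun) \<Rightarrow> bool" where
  "dag_cover G w f g D W \<longleftrightarrow>
     (\<forall>i<g. weighted_digraph (D i) (W i) \<and> acyclic (parcs (D i)) \<and> pverts (D i) = pverts G) \<and>
     card ((\<Union>i<g. weighted_arcs (D i) (W i)) - weighted_arcs G w) \<le> f"

(* For g = 0 the infimum is \<infinity>. *)
definition distance_preserving ::
  "real \<Rightarrow> 'a pair_pre_digraph \<Rightarrow> ('a \<times> 'a) weight_fun \<Rightarrow> nat \<Rightarrow>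
   (nat \<Rightarrow> 'a pair_pre_digraph) \<Rightarrow> (nat \<Rightarrow> ('a \<times> 'a) weight_fun) \<Rightarrow> bool" where
  "distance_preserving \<alpha> G w g D W \<longleftrightarrow>
     (\<forall>s\<in>pverts G. \<forall>t\<in>pverts G.
        dist_in G w s t \<le> (INF i\<in>{..<g}. dist_in (D i) (W i) s t) \<and>
        (INF i\<in>{..<g}. dist_in (D i) (W i) s t) \<le> ereal \<alpha> * dist_in G w s t)"

end

theory Submission
  imports Defs "HOL-Real_Asymp.Real_Asymp"
begin

text \<open>If a shortest path with \<open>M\<close> vertices is fixed, a uniformly random labelling of the vertices
  with \<open>M\<close> labels is increasing along it with probability at least \<open>1 / M ^ M\<close>, so about
  \<open>M ^ M * 2 * ln n\<close> labellings suffice to serve one such path for every pair; each labelling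
  yields the DAG of label-increasing arcs. Adding \<open>n\<^sup>2 / K\<^sup>2\<close> arcs weighted by distances makes
  \<open>M = 4 * K + 1\<close> vertices enough for all pairs. With \<open>K = ln n / (ln (ln n))\<^sup>2\<close> the number of DAGs
  is \<open>exp (O (K * ln K)) = exp (o (ln n))\<close>.\<close>

section \<open>Sparse exact hopsets\<close>

text \<open>Intended model: \<open>T\<close> is reachability and \<open>d\<close> the distance.
  \<open>d\<close> need not be symmetric and is meaningful only on \<open>T\<close>, so the triangle
  inequality is required only there.\<close>

locale partial_quasimetric =
  fixes V :: "'v set" and T :: "'v rel" and d :: "'v \<Rightarrow> 'v \<Rightarrow> real"
  assumes finite_V: "finite V"
    and T_subset: "T \<subseteq> V \<times> V"
    and T_refl: "x \<in> V \<Longrightarrow> (x, x) \<in> T"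
    and T_trans: "(x, y) \<in> T \<Longrightarrow> (y, z) \<in> T \<Longrightarrow> (x, z) \<in> T"
    and d_self: "x \<in> V \<Longrightarrow> d x x = 0"
    and d_triangle: "(x, y) \<in> T \<Longrightarrow> (y, z) \<in> T \<Longrightarrow> d x z \<le> d x y + d y z"
begin

lemma finite_T: "finite T"
  using finite_subset[OF T_subset] finite_V by simp

text \<open>Paths in \<open>A\<close> with exactly \<open>n\<close> hops that are shortest if every
  arc weighs the \<open>d\<close> of its endpoints. Additivity is recorded only for the first arc of
  each suffix.\<close>

fun geo :: "'v rel \<Rightarrow> nat \<Rightarrow> 'v \<Rightarrow> 'v \<Rightarrow> bool" where
  "geo A 0 s t \<longleftrightarrow> s = t \<and> s \<in> V"
| "geo A (Suc n) s t \<longleftrightarrow> (\<exists>m. (s, m) \<in> A \<and> geo A n m t \<and> d s t = d s m + d m t)"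

lemma geo_mono: "geo A n s t \<Longrightarrow> A \<subseteq> B \<Longrightarrow> geo B n s t"
  by (induction n arbitrary: s) auto

lemma geo_T: "geo A n s t \<Longrightarrow> A \<subseteq> T \<Longrightarrow> (s, t) \<in> T"
  by (induction n arbitrary: s) (auto intro: T_refl T_trans)

text \<open>The triangle inequalities for \<open>d s t\<close> (via \<open>u\<close>) and
  \<open>d u t\<close> (via \<open>m\<close>) chain up to the assumed value of \<open>d s t\<close>,
  so both are tight.\<close>

lemma geo_append:
  assumes "geo A i s m" "geo A j m t" "d s t = d s m + d m t" "A \<subseteq> T"
  shows "geo A (i + j) s t"
  using assms(1,3)
proof (induction i arbitrary: s)
  case 0
  then show ?case using assms(2) by simp
next
  case (Suc i)
  then obtain u where u: "(s, u) \<in> A" "geo A i u m" "d s m = d s u + d u m"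
    by auto
  have T: "(s, u) \<in> T" "(u, m) \<in> T" "(m, t) \<in> T"
    using u geo_T assms(2,4) by auto
  have "d s t \<le> d s u + d u t" "d u t \<le> d u m + d m t"
    by (meson T T_trans d_triangle)+
  then have "d s t = d s u + d u t" "d u t = d u m + d m t"
    using u(3) Suc.prems(2) by auto
  then show ?case using Suc.IH[OF u(2)] u(1) by auto
qed

text \<open>Vertex-sequence form of \<open>geo\<close>. Additivity for all triples, not just
  consecutive vertices, allows any segment to be cut out or replaced.\<close>

definition geodesic :: "'v rel \<Rightarrow> (nat \<Rightarrow> 'v) \<Rightarrow> nat \<Rightarrow> bool" where
  "geodesic A p h \<longleftrightarrow> (\<forall>i<h. (p i, p (Suc i)) \<in> A) \<and> (\<forall>i\<le>h. p i \<in> V) \<and>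
     (\<forall>i j k. i \<le> j \<longrightarrow> j \<le> k \<longrightarrow> k \<le> h \<longrightarrow> d (p i) (p k) = d (p i) (p j) + d (p j) (p k))"

lemma geodesicD:
  assumes "geodesic A p h"
  shows "i < h \<Longrightarrow> (p i, p (Suc i)) \<in> A"
    and "i \<le> h \<Longrightarrow> p i \<in> V"
    and "i \<le> j \<Longrightarrow> j \<le> k \<Longrightarrow> k \<le> h \<Longrightarrow> d (p i) (p k) = d (p i) (p j) + d (p j) (p k)"
  by (rule assms[unfolded geodesic_def, THEN conjunct1, rule_format]
      assms[unfolded geodesic_def, THEN conjunct2, THEN conjunct1, rule_format]
      assms[unfolded geodesic_def, THEN conjunct2, THEN conjunct2, rule_format]; assumption)+

lemma geodesic_change_arcs:
  assumes "geodesic A p h" "\<And>i. i < h \<Longrightarrow> (p i, p (Suc i)) \<in> B"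
  shows "geodesic B p h"
  unfolding geodesic_def
  by (intro conjI allI impI geodesicD(2,3)[OF assms(1)] assms(2))

lemma geo_segment:
  assumes "geodesic A p h" "i \<le> j" "j \<le> h"
  shows "geo A (j - i) (p i) (p j)"
  using assms(2)
proof (induction "j - i" arbitrary: i)
  case 0
  then show ?case using geodesicD(2)[OF assms(1)] assms(3) by simp
next
  case (Suc n)
  then have "geo A (j - Suc i) (p (Suc i)) (p j)" by simp
  moreover have "d (p i) (p j) = d (p i) (p (Suc i)) + d (p (Suc i)) (p j)"
    "(p i, p (Suc i)) \<in> A"
    using geodesicD(3)[OF assms(1), of i "Suc i" j] geodesicD(1)[OF assms(1), of i]
      Suc.hyps(2) assms(3) by auto
  moreover have "j - i = Suc (j - Suc i)" using Suc.hyps(2) by simp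
  ultimately show ?case by auto
qed

text \<open>The triangle inequality spreads additivity from the first arcs of suffixes to all
  triples; the induction prepends one vertex.\<close>

lemma geo_imp_geodesic:
  assumes "geo A h s t" "A \<subseteq> T"
  shows "\<exists>p. p 0 = s \<and> p h = t \<and> geodesic A p h"
  using assms(1)
proof (induction h arbitrary: s)
  case 0
  then show ?case by (intro exI[of _ "\<lambda>_. s"]) (auto simp: geodesic_def d_self)
next
  case (Suc h)
  then obtain m where m: "(s, m) \<in> A" "geo A h m t" "d s t = d s m + d m t"
    by auto
  from Suc.IH[OF m(2)] obtain p where p: "p 0 = m" "p h = t" "geodesic A p h" by blast
  note P = geodesicD[OF p(3)]
  have sV: "s \<in> V" using m(1) assms(2) T_subset by auto
  have T: "(p i, p j) \<in> T" if "i \<le> j" "j \<le> h" for i j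
    using geo_T[OF geo_segment[OF p(3) that] assms(2)] .
  have sT: "(s, p i) \<in> T" if "i \<le> h" for i
    using T[of 0 i] that p(1) m(1) assms(2) T_trans[of s m "p i"] by auto
  \<comment> \<open>A squeeze: \<open>d s t\<close> is at most \<open>d s (p i) + d (p i) t\<close>,
    which is at most \<open>d s m + d m (p i) + d (p i) t\<close>, and that equals
    \<open>d s t\<close>.\<close>
  have d0: "d s (p i) = d s m + d m (p i)" if "i \<le> h" for i
  proof -
    have "d s t \<le> d s (p i) + d (p i) t" "d s (p i) \<le> d s m + d m (p i)"
      using d_triangle[of s "p i" t] d_triangle[of s m "p i"]
        sT[OF that] T[of i h] T[of 0 i] that p m(1) assms(2) by auto
    moreover have "d m t = d m (p i) + d (p i) t"
      using P(3)[of 0 i h] that p by simp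
    ultimately show ?thesis using m(3) by linarith
  qed
  define q where "q = case_nat s p"
  have "d (q i) (q k) = d (q i) (q j) + d (q j) (q k)"
    if ijk: "i \<le> j" "j \<le> k" "k \<le> Suc h" for i j k
  proof (cases i)
    case (Suc i')
    then obtain j' k' where "j = Suc j'" "k = Suc k'"
      using ijk Suc by (cases j; cases k) auto
    then show ?thesis using Suc ijk P(3)[of i' j' k'] by (simp add: q_def)
  next
    case i: 0
    show ?thesis
    proof (cases j)
      case 0
      then show ?thesis using i d_self sV by (simp add: q_def)
    next
      case (Suc j')
      then obtain k' where k: "k = Suc k'" using ijk by (cases k) auto
      then show ?thesis
        using i Suc ijk d0[of j'] d0[of k'] P(3)[of 0 j' k'] p(1) by (simp add: q_def)
    qed
  qed
  moreover have "(q i, q (Suc i)) \<in> A" if "i < Suc h" for i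
    using that P(1) p(1) m(1) by (cases i) (auto simp: q_def)
  moreover have "q i \<in> V" if "i \<le> Suc h" for i
    using that P(2) sV by (cases i) (auto simp: q_def)
  ultimately have "geodesic A q (Suc h)" unfolding geodesic_def by blast
  moreover have "q 0 = s" "q (Suc h) = t" using p by (auto simp: q_def)
  ultimately show ?case by blast
qed

text \<open>Choose the fewest hops: a connection with fewer hops between two vertices of the path
  could be spliced in by \<open>geo_append\<close>.\<close>

lemma minimal_geodesic:
  assumes "geo A n s t" "A \<subseteq> T"
  shows "\<exists>h p. h \<le> n \<and> p 0 = s \<and> p h = t \<and> geodesic A p h \<and>
    (\<forall>i j l. i \<le> j \<longrightarrow> j \<le> h \<longrightarrow> l < j - i \<longrightarrow> \<not> geo A l (p i) (p j))"
proof -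
  define h where "h = (LEAST h. geo A h s t)"
  have h: "geo A h s t" "h \<le> n"
    unfolding h_def using assms(1) by (auto intro: LeastI Least_le)
  have least: "\<not> geo A l s t" if "l < h" for l
    using that unfolding h_def by (rule not_less_Least)
  from geo_imp_geodesic[OF h(1) assms(2)]
  obtain p where p: "p 0 = s" "p h = t" "geodesic A p h" by blast
  have False if ijl: "i \<le> j" "j \<le> h" "l < j - i" "geo A l (p i) (p j)" for i j l
  proof -
    have "geo A (l + (h - j)) (p i) (p h)"
      using geo_append[OF ijl(4) geo_segment[OF p(3), of j h]] geodesicD(3)[OF p(3), of i j h]
        ijl assms(2)
      by simp
    then have "geo A (i + (l + (h - j))) (p 0) (p h)"
      using geo_append[OF geo_segment[OF p(3), of 0 i], of "l + (h - j)" "p h"]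
        geodesicD(3)[OF p(3), of 0 i h] ijl assms(2)
      by simp
    moreover have "i + (l + (h - j)) < h" using ijl by linarith
    ultimately show False using least p by simp
  qed
  then show ?thesis using h(2) p by blast
qed

text \<open>A repeated vertex would bound a segment that the path with 0 hops replaces.\<close>

lemma minimal_geodesic_inj:
  assumes "geodesic A p h"
    and "\<And>i j l. i \<le> j \<Longrightarrow> j \<le> h \<Longrightarrow> l < j - i \<Longrightarrow> \<not> geo A l (p i) (p j)"
  shows "inj_on p {..h}"
proof (rule linorder_inj_onI)
  fix i j assume "i < j" "i \<in> {..h}" "j \<in> {..h}"
  then show "p i \<noteq> p j"
    using assms(2)[of i j 0] geodesicD(2)[OF assms(1), of i] by auto
qed auto

text \<open>Greedy construction: shortcutting the middle part of a minimal geodesic with more than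
  \<open>4 * K\<close> hops brings all \<open>K\<^sup>2\<close> pairs formed by one of its first and one of its last \<open>K\<close>
  vertices from more than \<open>2 * K\<close> to fewer than \<open>2 * K\<close> hops.\<close>

lemma sparse_hopset:
  assumes "A \<subseteq> T" "K \<ge> 1" "\<And>s t. (s, t) \<in> T \<Longrightarrow> \<exists>n. geo A n s t"
  shows "\<exists>H\<subseteq>T. card H * K\<^sup>2 \<le> card {(s, t) \<in> T. \<forall>n\<le>2 * K. \<not> geo A n s t} \<and>
    (\<forall>(s, t)\<in>T. \<exists>n\<le>4 * K. geo (A \<union> H) n s t)"
  using assms(1,3)
\<comment> \<open>Each round adds one arc and settles at least \<open>K\<^sup>2\<close> far pairs
  for good, so the initial far pairs pay for all arcs.\<close>
proof (induction "card {(s, t) \<in> T. \<forall>n\<le>2 * K. \<not> geo A n s t}" arbitrary: A rule: less_induct)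
  case less
  define far where "far B = {(s, t) \<in> T. \<forall>n\<le>2 * K. \<not> geo B n s t}" for B
  have far_finite: "finite (far B)" for B
    by (rule finite_subset[OF _ finite_T]) (auto simp: far_def)
  show ?case
  proof (cases "\<forall>(s, t)\<in>T. \<exists>n\<le>4 * K. geo A n s t")
    case True
    then show ?thesis by (intro exI[of _ "{}"]) auto
  next
    case False
    then obtain s t where st: "(s, t) \<in> T" "\<And>n. n \<le> 4 * K \<Longrightarrow> \<not> geo A n s t" by auto
    obtain n where "geo A n s t" using less.prems(2)[OF st(1)] by blast
    from minimal_geodesic[OF this less.prems(1)] obtain h p where
      p: "p 0 = s" "p h = t" "geodesic A p h" and
      min: "\<And>i j l. i \<le> j \<Longrightarrow> j \<le> h \<Longrightarrow> l < j - i \<Longrightarrow> \<not> geo A l (p i) (p j)"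
      by blast
    have h: "h > 4 * K"
      using st(2)[of h] geo_segment[OF p(3), of 0 h] p by (simp add: not_le[symmetric]) blast
    \<comment> \<open>The index sets \<open>{..a}\<close> and \<open>{b..h}\<close> have exactly
      \<open>K\<close> elements each, and \<open>h > 4 * K\<close> keeps them apart.\<close>
    define a b where "a = K - 1" and "b = h - a"
    have ab: "a < b" "b \<le> h" using h assms(2) by (auto simp: a_def b_def)
    have T: "(p i, p j) \<in> T" if "i \<le> j" "j \<le> h" for i j
      using geo_T[OF geo_segment[OF p(3) that] less.prems(1)] .
    define B where "B = insert (p a, p b) A"
    have B: "B \<subseteq> T" "A \<subseteq> B" using T ab less.prems(1) by (auto simp: B_def)
    \<comment> \<open>Along \<open>A\<close> to \<open>p a\<close>, over the new arc, then along
      \<open>A\<close> to \<open>p j\<close>: at most \<open>(K - 1) + 1 + (K - 1)\<close>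
      hops.\<close>
    have near: "geo B ((a - i) + (1 + (j - b))) (p i) (p j)" if "i \<le> a" "b \<le> j" "j \<le> h" for i j
    proof -
      note S = geo_segment[OF p(3), THEN geo_mono, OF _ _ B(2)] and D = geodesicD(3)[OF p(3)]
      have "geo B 1 (p a) (p b)"
        using ab geodesicD(2)[OF p(3), of b] d_self by (auto simp: B_def)
      then have "geo B (1 + (j - b)) (p a) (p j)"
        by (rule geo_append[OF _ S[of b j] D[of a b j] B(1)]) (use that ab in simp_all)
      from geo_append[OF _ this, of "a - i" "p i"] show ?thesis
        using S[of i a] D[of i a j] B(1) that ab by auto
    qed
    define Q where "Q = (\<lambda>(i, j). (p i, p j)) ` ({..a} \<times> {b..h})"
    have "inj_on p {..h}" by (rule minimal_geodesic_inj[OF p(3) min])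
    then have "inj_on (\<lambda>(i, j). (p i, p j)) ({..a} \<times> {b..h})"
      using ab by (auto simp: inj_on_def)
    then have "card Q = K\<^sup>2"
      using assms(2) h by (simp add: Q_def card_image a_def b_def power2_eq_square)
    moreover have "Q \<subseteq> far A - far B"
    proof -
      have "(p i, p j) \<in> far A - far B" if ij: "i \<le> a" "b \<le> j" "j \<le> h" for i j
      proof -
        \<comment> \<open>Here \<open>j - i\<close> is at least \<open>h - 2 * (K - 1)\<close>,
          hence more than \<open>2 * K\<close>, and minimality excludes fewer hops.\<close>
        have "\<not> geo A n (p i) (p j)" if "n \<le> 2 * K" for n
          using min[of i j n] ij that h assms(2) by (simp add: a_def b_def)
        moreover have "(a - i) + (1 + (j - b)) \<le> 2 * K"
          using ij assms(2) h by (simp add: a_def b_def)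
        ultimately show ?thesis
          using near[OF ij] T[of i j] ij ab unfolding far_def by fastforce
      qed
      then show ?thesis by (auto simp: Q_def)
    qed
    moreover have "far B \<subseteq> far A" using geo_mono[OF _ B(2)] by (fastforce simp: far_def)
    ultimately have "K\<^sup>2 \<le> card (far A) - card (far B)"
      using far_finite by (metis card_Diff_subset card_mono finite_Diff)
    moreover have "K\<^sup>2 > 0" using assms(2) by simp
    ultimately have card: "card (far B) + K\<^sup>2 \<le> card (far A)" by linarith
    then have "card (far B) < card (far A)" using \<open>K\<^sup>2 > 0\<close> by linarith
    from less.hyps[OF this[unfolded far_def] B(1)] less.prems(2) geo_mono[OF _ B(2)]
    obtain H where H: "H \<subseteq> T" "card H * K\<^sup>2 \<le> card (far B)"
      "\<forall>(s, t)\<in>T. \<exists>n\<le>4 * K. geo (B \<union> H) n s t"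
      unfolding far_def by meson
    \<comment> \<open>Only an inequality, since \<open>H\<close> may already contain the new
      arc.\<close>
    have "card (insert (p a, p b) H) * K\<^sup>2 \<le> (card H + 1) * K\<^sup>2"
      by (intro mult_right_mono) (simp_all add: card_insert_if finite_subset[OF H(1) finite_T])
    also have "\<dots> \<le> card (far A)" using H(2) card by simp
    finally have "card (insert (p a, p b) H) * K\<^sup>2 \<le> card (far A)" .
    moreover have "insert (p a, p b) H \<subseteq> T" using H(1) B(1) by (auto simp: B_def)
    moreover have "A \<union> insert (p a, p b) H = B \<union> H" by (auto simp: B_def)
    ultimately show ?thesis
      using H(3) by (intro exI[of _ "insert (p a, p b) H"]) (simp add: far_def)
  qed
qed

end

section \<open>Families of vertex labellings\<close>

lemma card_PiE_extending:
  assumes "finite V" "X \<subseteq> V" "c \<in> X \<rightarrow> {..<L}"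
  shows "card {\<phi> \<in> V \<rightarrow>\<^sub>E {..<L}. \<forall>x\<in>X. \<phi> x = c x} = L ^ (card V - card X)"
proof -
  have "{\<phi> \<in> V \<rightarrow>\<^sub>E {..<L}. \<forall>x\<in>X. \<phi> x = c x} = PiE V (\<lambda>x. if x \<in> X then {c x} else {..<L})"
    using assms(2,3) by (fastforce simp: PiE_iff split: if_splits)
  then have "card {\<phi> \<in> V \<rightarrow>\<^sub>E {..<L}. \<forall>x\<in>X. \<phi> x = c x} =
      (\<Prod>x\<in>V. card (if x \<in> X then {c x} else {..<L}))"
    using assms(1) by (simp add: card_PiE)
  also have "\<dots> = (\<Prod>x\<in>V. if x \<in> X then 1 else L)"
    by (rule prod.cong) auto
  also have "\<dots> = L ^ card (V - X)"
    using assms(1) by (simp add: prod.If_cases Diff_eq)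
  finally show ?thesis
    using assms(1,2) by (simp add: card_Diff_subset finite_subset)
qed

lemma card_Collect_eq_sum:
  "finite A \<Longrightarrow> card {x \<in> A. P x} = (\<Sum>x\<in>A. if P x then 1 else 0)"
  by (simp flip: sum.inter_filter)

text \<open>Averaging: each request \<open>q\<close> is met by at least one in \<open>L ^ L\<close>
  of all labellings, so by double counting some labelling meets at least that share of the
  requests.\<close>

lemma good_labelling:
  assumes "finite V" "finite Q" "L \<ge> 1"
    and "\<And>q. q \<in> Q \<Longrightarrow> X q \<subseteq> V \<and> card (X q) \<le> L \<and> c q \<in> X q \<rightarrow> {..<L}"
  shows "\<exists>\<phi>. card Q \<le> L ^ L * card {q \<in> Q. \<forall>x\<in>X q. \<phi> x = c q x}"
proof (rule ccontr)
  assume "\<not> ?thesis"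
  then have less: "L ^ L * card {q \<in> Q. \<forall>x\<in>X q. \<phi> x = c q x} < card Q" for \<phi>
    by (simp add: not_le)
  let ?\<Phi> = "V \<rightarrow>\<^sub>E {..<L}"
  have fin: "finite ?\<Phi>" using assms(1) by (simp add: finite_PiE)
  have card\<Phi>: "card ?\<Phi> = L ^ card V" using assms(1) by (simp add: card_PiE)
  \<comment> \<open>Nonemptiness is what makes the final comparison of sums strict.\<close>
  then have ne: "?\<Phi> \<noteq> {}" using assms(3) by (auto simp del: PiE_eq_empty_iff)
  have "card Q * L ^ card V = (\<Sum>q\<in>Q. L ^ card V)" by simp
  also have "\<dots> \<le> (\<Sum>q\<in>Q. L ^ L * card {\<phi> \<in> ?\<Phi>. \<forall>x\<in>X q. \<phi> x = c q x})"
  proof (rule sum_mono)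
    fix q assume "q \<in> Q"
    note q = assms(4)[OF this]
    \<comment> \<open>A request fixes at most \<open>L\<close> values, so at most a factor
      \<open>L ^ L\<close> of the labellings is lost.\<close>
    have "L ^ card V \<le> L ^ (L + (card V - card (X q)))"
      using q assms(3) by (intro power_increasing) auto
    then show "L ^ card V \<le> L ^ L * card {\<phi> \<in> ?\<Phi>. \<forall>x\<in>X q. \<phi> x = c q x}"
      using card_PiE_extending[of V "X q" "c q" L] assms(1) q by (simp add: power_add)
  qed
  also have "\<dots> = L ^ L * (\<Sum>q\<in>Q. \<Sum>\<phi>\<in>?\<Phi>. if \<forall>x\<in>X q. \<phi> x = c q x then 1 else 0)"
    using fin by (simp add: sum_distrib_left card_Collect_eq_sum)
  also have "\<dots> = (\<Sum>\<phi>\<in>?\<Phi>. L ^ L * card {q \<in> Q. \<forall>x\<in>X q. \<phi> x = c q x})"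
    using assms(2) by (subst sum.swap) (simp add: sum_distrib_left card_Collect_eq_sum)
  also have "\<dots> < (\<Sum>\<phi>\<in>?\<Phi>. card Q)"
    using less fin ne by (intro sum_strict_mono) auto
  also have "\<dots> = card Q * L ^ card V" using card\<Phi> by simp
  finally show False by simp
qed

text \<open>Greedy choice: \<open>good_labelling\<close>, applied to the requests still unmet,
  shrinks their number by the factor \<open>1 - 1 / L ^ L\<close> in each round.\<close>

lemma labelling_family_decay:
  assumes "finite V" "finite Q" "L \<ge> 1"
    and "\<And>q. q \<in> Q \<Longrightarrow> X q \<subseteq> V \<and> card (X q) \<le> L \<and> c q \<in> X q \<rightarrow> {..<L}"
  shows "\<exists>\<phi>. real (card {q \<in> Q. \<forall>i<g. \<exists>x\<in>X q. \<phi> i x \<noteq> c q x}) \<le> (1 - 1 / real L ^ L) ^ g * card Q"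
proof (induction g)
  case 0
  then show ?case by simp
next
  case (Suc g)
  then obtain \<phi> where
    IH: "real (card {q \<in> Q. \<forall>i<g. \<exists>x\<in>X q. \<phi> i x \<noteq> c q x}) \<le> (1 - 1 / real L ^ L) ^ g * card Q" ..
  define R where "R = {q \<in> Q. \<forall>i<g. \<exists>x\<in>X q. \<phi> i x \<noteq> c q x}"
  have R: "finite R" "R \<subseteq> Q" using assms(2) by (auto simp: R_def)
  obtain \<psi> where \<psi>: "card R \<le> L ^ L * card {q \<in> R. \<forall>x\<in>X q. \<psi> x = c q x}"
    using good_labelling[of V R L X c] assms R by blast
  define \<phi>' where "\<phi>' = \<phi>(g := \<psi>)"
  have eq: "{q \<in> Q. \<forall>i<Suc g. \<exists>x\<in>X q. \<phi>' i x \<noteq> c q x} = R - {q \<in> R. \<forall>x\<in>X q. \<psi> x = c q x}"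
    by (auto simp: R_def \<phi>'_def less_Suc_eq)
  have L: "real L ^ L > 0" "1 / real L ^ L \<le> 1" using assms(3) by simp_all
  have "real (card R) \<le> real L ^ L * card {q \<in> R. \<forall>x\<in>X q. \<psi> x = c q x}"
    using \<psi> by (simp flip: of_nat_mult of_nat_power)
  then have "card R / real L ^ L \<le> card {q \<in> R. \<forall>x\<in>X q. \<psi> x = c q x}"
    using L by (simp add: pos_divide_le_eq mult.commute)
  moreover have "real (card (R - {q \<in> R. \<forall>x\<in>X q. \<psi> x = c q x})) =
      real (card R) - card {q \<in> R. \<forall>x\<in>X q. \<psi> x = c q x}"
    using R by (subst card_Diff_subset) (auto intro!: of_nat_diff card_mono)
  ultimately have "real (card {q \<in> Q. \<forall>i<Suc g. \<exists>x\<in>X q. \<phi>' i x \<noteq> c q x})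
      \<le> (1 - 1 / real L ^ L) * card R"
    unfolding eq by (simp add: algebra_simps)
  also have "\<dots> \<le> (1 - 1 / real L ^ L) * ((1 - 1 / real L ^ L) ^ g * card Q)"
    using IH L by (intro mult_left_mono) (simp_all add: R_def)
  finally show ?case by (intro exI[of _ \<phi>']) (simp add: mult.assoc)
qed

text \<open>By \<open>1 - y \<le> exp (- y)\<close>, fewer than \<open>N / N = 1\<close> requests
  stay unmet after \<open>g\<close> rounds, hence none. The separate bound \<open>N\<close> keeps
  \<open>ln\<close> well behaved when \<open>Q\<close> is empty.\<close>

lemma labelling_family:
  assumes "finite V" "finite Q" "L \<ge> 1"
    and "\<And>q. q \<in> Q \<Longrightarrow> X q \<subseteq> V \<and> card (X q) \<le> L \<and> c q \<in> X q \<rightarrow> {..<L}"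
    and "card Q \<le> N" "N \<ge> 1" "real g > real L ^ L * ln N"
  shows "\<exists>\<phi>. \<forall>q\<in>Q. \<exists>i<g. \<forall>x\<in>X q. \<phi> i x = c q x"
proof -
  obtain \<phi> where
    \<phi>: "real (card {q \<in> Q. \<forall>i<g. \<exists>x\<in>X q. \<phi> i x \<noteq> c q x}) \<le> (1 - 1 / real L ^ L) ^ g * card Q"
    using labelling_family_decay[of V Q L X c g] assms(1-4) by blast
  have L: "real L ^ L > 0" "1 / real L ^ L \<le> 1" using assms(3) by simp_all
  have "(1 - 1 / real L ^ L) ^ g \<le> exp (- (1 / real L ^ L)) ^ g"
    using exp_ge_add_one_self[of "- (1 / real L ^ L)"] L by (intro power_mono) simp_all
  also have "\<dots> = exp (- (g / real L ^ L))" by (simp flip: exp_of_nat_mult)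
  also have "\<dots> < exp (- ln N)"
    using assms(7) L(1) by (simp add: pos_less_divide_eq mult.commute)
  also have "\<dots> = 1 / N" using assms(6) by (simp add: exp_minus field_simps)
  finally have "(1 - 1 / real L ^ L) ^ g * N < 1" using assms(6) by (simp add: field_simps)
  moreover have "(1 - 1 / real L ^ L) ^ g * card Q \<le> (1 - 1 / real L ^ L) ^ g * N"
    using L assms(5) by (intro mult_left_mono) auto
  ultimately have "real (card {q \<in> Q. \<forall>i<g. \<exists>x\<in>X q. \<phi> i x \<noteq> c q x}) < 1" using \<phi> by linarith
  then have "{q \<in> Q. \<forall>i<g. \<exists>x\<in>X q. \<phi> i x \<noteq> c q x} = {}" using assms(2) by simp
  then show ?thesis by blast
qed

section \<open>Walks and distances\<close>

context partial_quasimetric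
begin

text \<open>The triangle inequality, iterated along the walk. This is the reason why no DAG of the
  cover undercuts a distance.\<close>

lemma d_le_awalk_cost:
  assumes "pair_wf_digraph D" "pverts D = V"
    and "\<And>x y. (x, y) \<in> parcs D \<Longrightarrow> (x, y) \<in> T \<and> d x y \<le> W (x, y)"
    and "pre_digraph.awalk (with_proj D) s p t"
  shows "(s, t) \<in> T \<and> d s t \<le> wf_digraph.awalk_cost W p"
proof -
  interpret D: pair_wf_digraph D by fact
  show ?thesis
    using assms(4)
  proof (induction p arbitrary: s)
    case Nil
    then show ?case using assms(2) by (auto simp: D.awalk_Nil_iff T_refl d_self)
  next
    case (Cons e p)
    obtain y where e: "e = (s, y)" "(s, y) \<in> parcs D" "D.awalk y p t"
      using Cons.prems by (cases e) (auto simp: D.awalk_Cons_iff)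
    have "(s, y) \<in> T" "(y, t) \<in> T" "d s y \<le> W (s, y)" "d y t \<le> D.awalk_cost W p"
      using assms(3)[OF e(2)] Cons.IH[OF e(3)] by auto
    then show ?case using d_triangle[of s y t] T_trans[of s y t] by (simp add: e(1))
  qed
qed

text \<open>The counterpart: a \<open>geo\<close> path kept by a DAG weighted by \<open>d\<close>
  realises the distance.\<close>

lemma geo_imp_awalk:
  assumes "pair_wf_digraph D" "pverts D = V"
    and "\<And>x y. (x, y) \<in> parcs D \<Longrightarrow> W (x, y) = d x y"
    and "geo (parcs D) n s t"
  shows "\<exists>p. pre_digraph.awalk (with_proj D) s p t \<and>
    wf_digraph.awalk_cost W p = d s t"
proof -
  interpret D: pair_wf_digraph D by fact
  show ?thesis
    using assms(4)
  proof (induction n arbitrary: s)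
    case 0
    then show ?case using assms(2) by (intro exI[of _ "[]"]) (auto simp: D.awalk_Nil_iff d_self)
  next
    case (Suc n)
    then obtain m where m: "(s, m) \<in> parcs D" "geo (parcs D) n m t" "d s t = d s m + d m t"
      by auto
    from Suc.IH[OF m(2)] obtain p where "D.awalk m p t" "D.awalk_cost W p = d m t" by blast
    then show ?case
      using m assms(3)[OF m(1)] D.in_arcsD1[OF m(1)]
      by (intro exI[of _ "(s, m) # p"]) (auto simp: D.awalk_Cons_iff)
  qed
qed

text \<open>A walk that attains \<open>d s t\<close> leaves no slack in the triangle inequality, so
  every arc on it weighs exactly the distance of its endpoints.\<close>

lemma shortest_awalk_imp_geo:
  assumes "pair_wf_digraph D" "pverts D = V"
    and "\<And>x y. (x, y) \<in> parcs D \<Longrightarrow> (x, y) \<in> T \<and> d x y \<le> W (x, y)"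
    and "pre_digraph.awalk (with_proj D) s p t" "wf_digraph.awalk_cost W p = d s t"
  shows "geo {(x, y) \<in> parcs D. W (x, y) = d x y} (length p) s t"
proof -
  interpret D: pair_wf_digraph D by fact
  show ?thesis
    using assms(4,5)
  proof (induction p arbitrary: s)
    case Nil
    then show ?case using assms(2) by (auto simp: D.awalk_Nil_iff)
  next
    case (Cons e p)
    obtain y where e: "e = (s, y)" "(s, y) \<in> parcs D" "D.awalk y p t"
      using Cons.prems by (cases e) (auto simp: D.awalk_Cons_iff)
    have "(s, y) \<in> T" "d s y \<le> W (s, y)" "(y, t) \<in> T" "d y t \<le> D.awalk_cost W p"
      using assms(3)[OF e(2)] d_le_awalk_cost[OF assms(1-3) e(3)] by auto
    moreover have "d s t = W (s, y) + D.awalk_cost W p"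
      using Cons.prems(2) by (simp add: e(1))
    ultimately have "W (s, y) = d s y" "D.awalk_cost W p = d y t" "d s t = d s y + d y t"
      using d_triangle[of s y t] by auto
    then show ?case using Cons.IH[OF e(3)] e(2) by auto
  qed
qed

end

text \<open>Nonnegative weights exclude negative cycles, so the infimum over walks is attained as
  soon as there is a walk.\<close>

lemma dist_in_cases:
  assumes "weighted_digraph G w"
  obtains "\<And>p. \<not> pre_digraph.awalk (with_proj G) s p t" "dist_in G w s t = \<infinity>"
  | p where "pre_digraph.awalk (with_proj G) s p t"
      "dist_in G w s t = ereal (wf_digraph.awalk_cost w p)"
proof -
  interpret G: pair_fin_digraph G using assms by (simp add: weighted_digraph_def)
  have "0 \<le> w e" if "e \<in> parcs G" for e
    using assms that by (simp add: weighted_digraph_def)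
  then show ?thesis
    using that G.min_cost_awalk[of s t w] G.shortest_path_inf[of s t w] G.reachable_awalk[of s t]
    unfolding dist_in_def G.apath_def by blast
qed

text \<open>\<open>real_of_ereal\<close> maps infinity to 0; this is harmless because the triangle
  inequality is only claimed for reachable pairs.\<close>

lemma partial_quasimetric_dist_in:
  assumes "weighted_digraph G w"
  defines "T \<equiv> {(s, t). \<exists>p. pre_digraph.awalk (with_proj G) s p t}"
  shows "partial_quasimetric (pverts G) T (\<lambda>s t. real_of_ereal (dist_in G w s t))"
proof -
  interpret G: pair_fin_digraph G using assms by (simp add: weighted_digraph_def)
  let ?d = "\<lambda>s t. real_of_ereal (dist_in G w s t)"
  have le: "?d s t \<le> G.awalk_cost w p" if "G.awalk s p t" for s t p
    using that G.min_cost_le_walk_cost[OF that, of w]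
    by (cases rule: dist_in_cases[OF assms(1), of s t]) (auto simp: dist_in_def)
  have ex: "\<exists>p. G.awalk s p t \<and> G.awalk_cost w p = ?d s t" if "(s, t) \<in> T" for s t
    using that by (cases rule: dist_in_cases[OF assms(1), of s t]) (auto simp: T_def)
  have nonneg: "0 \<le> G.awalk_cost w p" if "G.awalk s p t" for s t p
    using G.pos_cost_pos_awalk_cost[OF that] assms(1) by (simp add: weighted_digraph_def)
  show ?thesis
  proof
    show "finite (pverts G)" by (rule G.pair_finite_verts)
    show "T \<subseteq> pverts G \<times> pverts G"
      using G.awalk_hd_in_verts G.awalk_last_in_verts by (auto simp: T_def)
    show refl: "(x, x) \<in> T" if "x \<in> pverts G" for x
      using that G.awalk_Nil_iff by (auto simp: T_def)
    show "(x, z) \<in> T" if "(x, y) \<in> T" "(y, z) \<in> T" for x y z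
      using that G.awalk_appendI unfolding T_def by blast
    show "?d x x = 0" if "x \<in> pverts G" for x
    proof (rule antisym)
      show "?d x x \<le> 0" using le[of x "[]" x] that by (simp add: G.awalk_Nil_iff)
      show "0 \<le> ?d x x" using ex[OF refl[OF that]] nonneg by metis
    qed
    show "?d x z \<le> ?d x y + ?d y z" if xyz: "(x, y) \<in> T" "(y, z) \<in> T" for x y z
    proof -
      obtain p where p: "G.awalk x p y" "G.awalk_cost w p = ?d x y"
        using ex[OF xyz(1)] by blast
      obtain q where q: "G.awalk y q z" "G.awalk_cost w q = ?d y z"
        using ex[OF xyz(2)] by blast
      show ?thesis using le[OF G.awalk_appendI[OF p(1) q(1)]] p(2) q(2) by simp
    qed
  qed
qed

section \<open>The cover\<close>

text \<open>Combines the hopset with the labellings: the requests are the reachable pairs, at most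
  \<open>n\<^sup>2\<close> many, each with a path on at most \<open>4 * K + 1\<close> vertices. The
  \<open>max 1\<close> covers the empty graph.\<close>

lemma dag_cover_exists:
  fixes G :: "'a pair_pre_digraph" and w :: "('a \<times> 'a) weight_fun"
  assumes G: "weighted_digraph G w" and K: "K \<ge> 1"
    and g: "real g > real (4 * K + 1) ^ (4 * K + 1) * ln (real (max 1 ((card (pverts G))\<^sup>2)))"
  shows "\<exists>D W. dag_cover G w ((card (pverts G))\<^sup>2 div K\<^sup>2) g D W \<and>
    distance_preserving 1 G w g D W"
proof -
  interpret G: pair_fin_digraph G using G by (simp add: weighted_digraph_def)
  define V where "V = pverts G"
  define L where "L = 4 * K + 1"
  define T where "T = {(s, t). \<exists>p. G.awalk s p t}"
  define d where "d = (\<lambda>s t. real_of_ereal (dist_in G w s t))"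
  interpret M: partial_quasimetric V T d
    unfolding V_def T_def d_def by (rule partial_quasimetric_dist_in[OF G])
  have card_T: "card T \<le> (card V)\<^sup>2"
    using card_mono[OF _ M.T_subset] M.finite_V by (simp add: card_cartesian_product power2_eq_square)
  have dist_T: "dist_in G w s t = ereal (d s t)" if "(s, t) \<in> T" for s t
    using that by (cases rule: dist_in_cases[OF G, of s t]) (auto simp: T_def d_def)
  have dist_notT: "dist_in G w s t = \<infinity>" if "(s, t) \<notin> T" for s t
    using that by (cases rule: dist_in_cases[OF G, of s t]) (auto simp: T_def)
  have d_nonneg: "0 \<le> d s t" for s t
  proof (cases rule: dist_in_cases[OF G, of s t])
    case (2 p)
    then show ?thesis
      using G.pos_cost_pos_awalk_cost[of s p t w] G by (simp add: d_def weighted_digraph_def)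
  qed (simp add: d_def)
  have arcs: "(x, y) \<in> T \<and> d x y \<le> w (x, y)" if "(x, y) \<in> parcs G" for x y
  proof -
    have walk: "G.awalk x [(x, y)] y"
      using that by (auto simp: G.awalk_simps dest: G.wellformed')
    then have T: "(x, y) \<in> T" by (auto simp: T_def)
    then show ?thesis
      using G.min_cost_le_walk_cost[OF walk, of w] dist_T[OF T] by (simp add: dist_in_def)
  qed
  \<comment> \<open>The DAGs weigh arcs by \<open>d\<close>, so these are the arcs of
    \<open>G\<close> that they can use with unchanged weight, at no charge. They carry all shortest
    walks.\<close>
  define E where "E = {(x, y) \<in> parcs G. w (x, y) = d x y}"
  have "E \<subseteq> T" using arcs by (auto simp: E_def)
  have geo_E: "\<exists>n. M.geo E n s t" if "(s, t) \<in> T" for s t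
  proof (cases rule: dist_in_cases[OF G, of s t])
    case 1
    then show ?thesis using that by (auto simp: T_def)
  next
    case (2 p)
    then have "G.awalk_cost w p = d s t" by (simp add: d_def)
    from M.shortest_awalk_imp_geo[OF G.pair_wf_digraph_axioms _ arcs 2(1) this]
    show ?thesis by (auto simp: V_def E_def)
  qed
  have "\<exists>H\<subseteq>T. card H * K\<^sup>2 \<le> card {(s, t) \<in> T. \<forall>n\<le>2 * K. \<not> M.geo E n s t} \<and>
      (\<forall>(s, t)\<in>T. \<exists>n\<le>4 * K. M.geo (E \<union> H) n s t)"
    by (rule M.sparse_hopset[OF \<open>E \<subseteq> T\<close> K geo_E])
  then obtain H where
    H: "H \<subseteq> T" "card H * K\<^sup>2 \<le> card {(s, t) \<in> T. \<forall>n\<le>2 * K. \<not> M.geo E n s t}"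
    and hop: "\<forall>(s, t)\<in>T. \<exists>n\<le>4 * K. M.geo (E \<union> H) n s t"
    by (elim exE conjE)
  have "card {(s, t) \<in> T. \<forall>n\<le>2 * K. \<not> M.geo E n s t} \<le> card T"
    by (intro card_mono M.finite_T) auto
  then have "card H * K\<^sup>2 \<le> (card V)\<^sup>2" using H(2) card_T by linarith
  then have card_H: "card H \<le> (card V)\<^sup>2 div K\<^sup>2"
    using K by (simp add: less_eq_div_iff_mult_less_eq)
  define A where "A = E \<union> H"
  have A: "A \<subseteq> T" using \<open>E \<subseteq> T\<close> H(1) by (simp add: A_def)
  \<comment> \<open>Injectivity matters because a vertex is to be labelled by its position on the
    path.\<close>
  define good where "good q p h \<longleftrightarrow> h \<le> 4 * K \<and> p 0 = fst q \<and> p h = snd q \<and>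
    M.geodesic A p h \<and> inj_on p {..h}" for q p h
  have "\<exists>ph. good q (fst ph) (snd ph)" if q: "q \<in> T" for q
  proof -
    obtain n where n: "n \<le> 4 * K" "M.geo A n (fst q) (snd q)"
      using bspec[OF hop q] by (auto simp: A_def)
    from M.minimal_geodesic[OF n(2) A] obtain h p where
      p: "h \<le> n" "p 0 = fst q" "p h = snd q" "M.geodesic A p h" and
      min: "\<And>i j l. i \<le> j \<Longrightarrow> j \<le> h \<Longrightarrow> l < j - i \<Longrightarrow> \<not> M.geo A l (p i) (p j)"
      by blast
    have "inj_on p {..h}" by (rule M.minimal_geodesic_inj[OF p(4) min])
    then show ?thesis using p n(1) by (intro exI[of _ "(p, h)"]) (simp add: good_def)
  qed
  then obtain F where F: "\<And>q. q \<in> T \<Longrightarrow> good q (fst (F q)) (snd (F q))" by metis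
  define P h where "P q = fst (F q)" and "h q = snd (F q)" for q
  have P: "h q \<le> 4 * K" "P q 0 = fst q" "P q (h q) = snd q"
    "M.geodesic A (P q) (h q)" "inj_on (P q) {..h q}" if "q \<in> T" for q
    using F[OF that] by (simp_all add: good_def P_def h_def)
  define X where "X q = P q ` {..h q}" for q
  define c where "c q = the_inv_into {..h q} (P q)" for q
  have c: "c q (P q i) = i" if "q \<in> T" "i \<le> h q" for q i
    using the_inv_into_f_f[OF P(5)[OF that(1)], of i] that by (simp add: c_def)
  have X: "X q \<subseteq> V \<and> card (X q) \<le> L \<and> c q \<in> X q \<rightarrow> {..<L}" if q: "q \<in> T" for q
  proof (intro conjI)
    show "X q \<subseteq> V" using M.geodesicD(2)[OF P(4)[OF q]] by (auto simp: X_def)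
    have "card (X q) \<le> card {..h q}" unfolding X_def by (rule card_image_le) simp
    then show "card (X q) \<le> L" using P(1)[OF q] by (simp add: L_def)
    show "c q \<in> X q \<rightarrow> {..<L}" using c[OF q] P(1)[OF q] by (fastforce simp: X_def L_def)
  qed
  have "\<exists>\<phi>. \<forall>q\<in>T. \<exists>i<g. \<forall>x\<in>X q. \<phi> i x = c q x"
  proof (rule labelling_family[OF M.finite_V M.finite_T _ X])
    show "card T \<le> max 1 ((card V)\<^sup>2)" using card_T by simp
    show "real L ^ L * ln (real (max 1 ((card V)\<^sup>2))) < real g"
      using g unfolding L_def V_def .
  qed (simp_all add: L_def)
  then obtain \<phi> where \<phi>: "\<And>q. q \<in> T \<Longrightarrow> \<exists>i<g. \<forall>x\<in>X q. \<phi> i x = c q x"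
    by blast
  define D where "D i = \<lparr>pverts = V, parcs = {(x, y) \<in> A. \<phi> i x < \<phi> i y}\<rparr>" for i
  \<comment> \<open>The weights are the same for all \<open>i\<close>, so an arc used by many DAGs
    counts only once.\<close>
  define W where "W i = (\<lambda>(x, y). d x y)" for i :: nat
  have D: "pair_fin_digraph (D i)" for i
  proof
    show "finite (parcs (D i))"
      by (rule finite_subset[OF _ M.finite_T]) (use A in \<open>auto simp: D_def\<close>)
  qed (use A M.T_subset M.finite_V in \<open>auto simp: D_def\<close>)
  then have wfD: "pair_wf_digraph (D i)" for i
    by (simp add: pair_fin_digraph_def)
  have "weighted_digraph (D i) (W i)" for i
    using D d_nonneg by (simp add: weighted_digraph_def W_def split_beta)
  moreover have "acyclic (parcs (D i))" for i
    by (rule acyclic_subset[OF wf_acyclic[OF wf_measure[of "\<phi> i"]]]) (auto simp: D_def)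
  moreover have "card ((\<Union>i<g. weighted_arcs (D i) (W i)) - weighted_arcs G w) \<le> card H"
  proof -
    have "(\<Union>i<g. weighted_arcs (D i) (W i)) - weighted_arcs G w \<subseteq> (\<lambda>(x, y). ((x, y), d x y)) ` H"
      by (auto simp: weighted_arcs_def D_def W_def A_def E_def image_iff)
    moreover have "finite H" using H(1) M.finite_T finite_subset by blast
    ultimately show ?thesis
      by (meson card_image_le card_mono finite_imageI le_trans)
  qed
  ultimately have cover: "dag_cover G w ((card V)\<^sup>2 div K\<^sup>2) g D W"
    using card_H by (simp add: dag_cover_def D_def V_def)
  have lower: "dist_in G w s t \<le> dist_in (D i) (W i) s t" for i s t
  proof -
    interpret D: pair_fin_digraph "D i" by (rule D)
    have arcs_D: "(x, y) \<in> T \<and> d x y \<le> W i (x, y)" if "(x, y) \<in> parcs (D i)" for x y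
      using that A by (auto simp: D_def W_def)
    have verts_D: "pverts (D i) = V" by (simp add: D_def)
    have "dist_in G w s t \<le> ereal (D.awalk_cost (W i) p)" if p: "D.awalk s p t" for p
    proof -
      have "(s, t) \<in> T \<and> d s t \<le> D.awalk_cost (W i) p"
        by (rule M.d_le_awalk_cost[OF wfD verts_D arcs_D p])
      then show ?thesis using dist_T[of s t] by simp
    qed
    then show ?thesis
      unfolding dist_in_def[of "D i"] D.\<mu>_def by (auto intro!: INF_greatest)
  qed
  have upper: "(INF i\<in>{..<g}. dist_in (D i) (W i) s t) \<le> dist_in G w s t" for s t
  proof (cases "(s, t) \<in> T")
    case True
    from \<phi>[OF this] obtain i where i: "i < g" "\<And>x. x \<in> X (s, t) \<Longrightarrow> \<phi> i x = c (s, t) x" by blast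
    \<comment> \<open>Labels equal positions, so they increase along the chosen path and
      \<open>D i\<close> keeps all of its arcs.\<close>
    have label: "\<phi> i (P (s, t) j) = j" if "j \<le> h (s, t)" for j
      using i(2)[of "P (s, t) j"] c[OF True that] that by (simp add: X_def)
    have "M.geodesic (parcs (D i)) (P (s, t)) (h (s, t))"
      using M.geodesicD(1)[OF P(4)[OF True]] label
      by (intro M.geodesic_change_arcs[OF P(4)[OF True]]) (simp add: D_def)
    from M.geo_segment[OF this, of 0 "h (s, t)"]
    have geo: "M.geo (parcs (D i)) (h (s, t)) s t" using P[OF True] by simp
    interpret D: pair_fin_digraph "D i" by (rule D)
    obtain p where "D.awalk s p t" "D.awalk_cost (W i) p = d s t"
      using M.geo_imp_awalk[OF wfD _ _ geo, of "W i"] by (auto simp: D_def W_def)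
    then have "dist_in (D i) (W i) s t \<le> dist_in G w s t"
      using D.min_cost_le_walk_cost[of s p t "W i"] dist_T[OF True] by (simp add: dist_in_def)
    then show ?thesis using i(1) by (meson INF_lower2 lessThan_iff)
  qed (simp add: dist_notT)
  have "distance_preserving 1 G w g D W"
    unfolding distance_preserving_def using lower upper
    by (auto intro!: INF_greatest simp flip: one_ereal_def)
  then show ?thesis using cover unfolding V_def by blast
qed

section \<open>Choice of parameters and asymptotics\<close>

theorem theorem2:
  shows "\<exists>(f :: nat \<Rightarrow> nat) (g :: nat \<Rightarrow> nat) (\<epsilon> :: nat \<Rightarrow> real).
    (\<lambda>n. real (f n)) \<in> O(\<lambda>n. real n ^ 2 * ln (ln (real n)) ^ 4 / ln (real n) ^ 2) \<and>
    \<epsilon> \<longlonglongrightarrow> 0 \<and>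
    (\<forall>\<^sub>F n in sequentially. real (g n) \<le> real n powr \<epsilon> n) \<and>
    (\<forall>(G :: 'a pair_pre_digraph) (w :: ('a \<times> 'a) weight_fun).
       weighted_digraph G w \<longrightarrow>
       (\<exists>D W. dag_cover G w (f (card (pverts G))) (g (card (pverts G))) D W \<and>
              distance_preserving 1 G w (g (card (pverts G))) D W))"
proof -
  define x where "x n = ln (real n) / ln (ln (real n)) ^ 2" for n :: nat
  \<comment> \<open>\<open>max 1\<close> ensures \<open>K n \<ge> 1\<close> also for small
    \<open>n\<close>, where \<open>x n\<close> may have no useful value.\<close>
  define K where "K n = max 1 (nat \<lfloor>x n\<rfloor>)" for n
  define f where "f n = n\<^sup>2 div (K n)\<^sup>2" for n
  \<comment> \<open>The final \<open>+ 1\<close> gives the strict inequality that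
    \<open>dag_cover_exists\<close> demands.\<close>
  define g where "g n = nat \<lceil>real (4 * K n + 1) ^ (4 * K n + 1) * ln (real (max 1 (n\<^sup>2)))\<rceil> + 1" for n
  \<comment> \<open>An upper bound for \<open>g n\<close> with \<open>K n\<close> relaxed to the
    real number \<open>x n\<close>; the 2 absorbs the rounding and the \<open>+ 1\<close>.
    \<open>\<epsilon>\<close> is then chosen so that
    \<open>n powr \<epsilon> n = b n\<close>.\<close>
  define b where "b n = (4 * x n + 1) powr (4 * x n + 1) * (2 * ln (real n)) + 2" for n
  define \<epsilon> where "\<epsilon> n = ln (b n) / ln (real n)" for n
  have x2: "\<forall>\<^sub>F n in sequentially. x n \<ge> 2"
    unfolding x_def by real_asymp
  have "\<forall>\<^sub>F n in sequentially. norm (real (f n)) \<le>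
      4 * norm (real n ^ 2 * ln (ln (real n)) ^ 4 / ln (real n) ^ 2)"
    using x2
  proof eventually_elim
    case (elim n)
    \<comment> \<open>For \<open>x n \<ge> 2\<close>, rounding down loses at most half; squaring
      this gives the constant 4.\<close>
    have K: "x n / 2 \<le> real (K n)" using elim by (simp add: K_def) linarith
    have "real (f n) \<le> real (n\<^sup>2) / real ((K n)\<^sup>2)"
      unfolding f_def by (rule of_nat_div_le_of_nat)
    also have "\<dots> \<le> real n ^ 2 / (x n / 2) ^ 2"
      using elim K by (auto intro!: divide_left_mono power_mono mult_pos_pos)
    also have "\<dots> = 4 * (real n ^ 2 * ln (ln (real n)) ^ 4 / ln (real n) ^ 2)"
      by (simp add: x_def power_divide field_simps flip: power_mult)
    finally show ?case by simp
  qed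
  then have "(\<lambda>n. real (f n)) \<in> O(\<lambda>n. real n ^ 2 * ln (ln (real n)) ^ 4 / ln (real n) ^ 2)"
    by (rule bigoI)
  \<comment> \<open>The dominant term of \<open>ln (b n)\<close> is about
    \<open>4 * x n * ln (x n)\<close>, of order \<open>ln n / ln (ln n)\<close>, which is
    \<open>o(ln n)\<close>.\<close>
  moreover have "\<epsilon> \<longlonglongrightarrow> 0"
    unfolding \<epsilon>_def b_def x_def by real_asymp
  moreover have "\<forall>\<^sub>F n in sequentially. real (g n) \<le> real n powr \<epsilon> n"
    using x2 eventually_ge_at_top[of 2]
  proof eventually_elim
    case (elim n)
    let ?L = "4 * K n + 1"
    have ln_n: "ln (real n) > 0" using elim(2) by simp
    have "real (K n) \<le> x n" using elim(1) by (simp add: K_def)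
    then have L: "real ?L \<le> 4 * x n + 1" by simp
    have "real ?L ^ ?L = real ?L powr real ?L" by (rule powr_realpow[symmetric]) simp
    also have "\<dots> \<le> (4 * x n + 1) powr real ?L" using L by (intro powr_mono2) auto
    also have "\<dots> \<le> (4 * x n + 1) powr (4 * x n + 1)" using L elim(1) by (intro powr_mono) auto
    finally have *: "real ?L ^ ?L \<le> (4 * x n + 1) powr (4 * x n + 1)" .
    have "real (max 1 (n\<^sup>2)) = real n ^ 2" using elim(2) by (simp add: max_def)
    then have ln: "ln (real (max 1 (n\<^sup>2))) = 2 * ln (real n)" using elim(2) by (simp add: ln_realpow)
    have "real (nat \<lceil>y\<rceil> + 1) \<le> y + 2" if "y \<ge> 0" for y :: real
      using that by linarith
    from this[of "real ?L ^ ?L * (2 * ln (real n))"]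
    have "real (g n) \<le> real ?L ^ ?L * (2 * ln (real n)) + 2"
      unfolding g_def ln using ln_n by simp
    also have "\<dots> \<le> b n"
      using * ln_n by (simp add: b_def)
    also have "b n = real n powr \<epsilon> n"
    proof -
      have "b n > 0" using ln_n by (simp add: b_def add_nonneg_pos)
      then show ?thesis using ln_n elim(2) by (simp add: \<epsilon>_def powr_def)
    qed
    finally show ?case .
  qed
  moreover have "\<exists>D W. dag_cover G w (f (card (pverts G))) (g (card (pverts G))) D W \<and>
      distance_preserving 1 G w (g (card (pverts G))) D W"
    if "weighted_digraph G w" for G :: "'a pair_pre_digraph" and w
  proof -
    have "real (4 * K n + 1) ^ (4 * K n + 1) * ln (real (max 1 (n\<^sup>2))) < real (g n)" for n
      unfolding g_def by linarith
    then show ?thesis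
      unfolding f_def using that by (intro dag_cover_exists) (simp_all add: K_def)
  qed
  ultimately show ?thesis by blast
qed

end
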